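(* For every $0<p<1$, the parabolic maximal operator $M_{\mathrm{par}}$ is not bounded from $H^{p,*}_{\mathrm{par}}(\mathbb{R}^2)$ to $L^{p,\infty}(\mathbb{R}^2)$; that is, there is no finite constant $C$ such that $\|M_{\mathrm{par}}f\|_{L^{p,\infty}(\mathbb{R}^2)}\le C\|f\|_{H^{p,*}_{\mathrm{par}}(\mathbb{R}^2)}$ for all $f\in H^{p,*}_{\mathrm{par}}(\mathbb{R}^2)$.
   Context: Fix a nonnegative smooth bump function $\varphi$ on $\mathbb{R}$ with $\varphi\le 1$, $\varphi\equiv 1$ on $(1,2)$ and $\operatorname{supp}\varphi\subseteq(1/2,5/2)$. For $f\in L^1_{\mathrm{loc}}(\mathbb{R}^2)$ and $r>0$ let $$A_rf(x)=\int_{\mathbb{R}}f(x_1-t,x_2-t^2)\,\varphi(t/r)\,\frac{dt}{r},\qquad M_{\mathrm{par}}f(x)=\sup_{r>0}|A_rf(x)|,$$ which is understood for almost every $x=(x_1,x_2)\in\mathbb{R}^2$. A parabolic box is a set $Q=Q(z,\rho)=z+[-\rho,\rho]\times[-\rho^2,\rho^2]$ with $z\in\mathbb{R}^2$, $\rho>0$; its side length is $\rho_Q=\rho(Q)=\rho$. For $0<p\le1$ fix a positive integer $N_p\ge\lfloor 3(1/p-1)\rfloor$. A parabolic $(p,\infty)$-atom (supported in, or associated with, $Q$) is a bounded measurable function $a$ on $\mathbb{R}^2$ for which there is a parabolic box $Q$ with $\operatorname{supp}a\subset Q$, $\|a\|_{L^\infty(\mathbb{R}^2)}\le|Q|^{-1/p}$,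 and $\int_{\mathbb{R}^2}x^\beta a(x)\,dx=0$ for all $\beta=(\beta_1,\beta_2)\in\mathbb{N}^2$ (with $0\in\mathbb{N}$) with $|\beta|=\beta_1+\beta_2\le N_p$, where $x^\beta=x_1^{\beta_1}x_2^{\beta_2}$. The parabolic scale cost of $Q$ is $w_p(Q)=[\min\{1,\rho_Q\}]^{2p-2}$. $H^{p,*}_{\mathrm{par}}(\mathbb{R}^2)$ is the space of all $f\in L^1_{\mathrm{loc}}(\mathbb{R}^2)$ admitting a (finite or countable) representation $f=\sum_Q\lambda_Qa_Q$, converging in $L^1_{\mathrm{loc}}(\mathbb{R}^2)$, where each $a_Q$ is a parabolic $(p,\infty)$-atom supported in the parabolic box $Q$ and $\sum_Q|\lambda_Q|^pw_p(Q)<\infty$; $\|f\|_{H^{p,*}_{\mathrm{par}}}$ is the infimum of $\left(\sum_Q|\lambda_Q|^pw_p(Q)\right)^{1/p}$ over all such representations. For measurable $f$, $\|f\|_{L^{p,\infty}(\mathbb{R}^2)}=\sup_{\alpha>0}\alpha\,|\{x\in\mathbb{R}^2:|f(x)|>\alpha\}|^{1/p}$, and $L^{p,\infty}(\mathbb{R}^2)$ is the space of measurable $f$ for which this is finite. *)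

theory Defs
  imports "HOL-Analysis.Analysis"
begin

text \<open>
  Functions on the plane have type \<^typ>\<open>real \<times> real \<Rightarrow> complex\<close>; they stand for their almost
  everywhere classes. All integrals are taken with respect to \<^const>\<open>lebesgue\<close> rather than
  \<^const>\<open>lborel\<close>, because measurable means Lebesgue measurable and the Bochner integral of a function
  that is not Borel measurable with respect to \<^const>\<open>lborel\<close> would be the default value 0.
\<close>

definition smooth :: "(real \<Rightarrow> real) \<Rightarrow> bool" where
  "smooth \<phi> \<longleftrightarrow> (\<forall>n x. (deriv ^^ n) \<phi> differentiable (at x))"

definition par_bump :: "(real \<Rightarrow> real) \<Rightarrow> bool" where
  "par_bump \<phi> \<longleftrightarrow> smooth \<phi> \<and> (\<forall>t. 0 \<le> \<phi> t \<and> \<phi> t \<le> 1) \<and> (\<forall>t\<in>{1<..<2}. \<phi> t = 1) \<and>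
     closure {t. \<phi> t \<noteq> 0} \<subseteq> {1/2<..<5/2}"

definition L1_loc :: "(real \<times> real \<Rightarrow> complex) set" where
  "L1_loc = {f. \<forall>K. compact K \<longrightarrow> set_integrable lebesgue K f}"

definition converges_L1_loc ::
    "(nat \<Rightarrow> real \<times> real \<Rightarrow> complex) \<Rightarrow> (real \<times> real \<Rightarrow> complex) \<Rightarrow> bool" where
  "converges_L1_loc F f \<longleftrightarrow> (\<forall>n. F n \<in> L1_loc) \<and> f \<in> L1_loc \<and>
     (\<forall>K. compact K \<longrightarrow> (\<lambda>n. LINT x:K|lebesgue. norm (F n x - f x)) \<longlonglongrightarrow> 0)"

text \<open>
  For locally integrable \<open>f\<close>, Fubini's theorem shows that for almost every \<open>x\<close> the integrand below is
  integrable for all \<open>r > 0\<close>, and that changing \<open>f\<close> on a null set changes \<open>par_max \<phi> f\<close> only on a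
  null set. The exceptional \<open>x\<close>, where the integral may take its default value 0, are irrelevant.
\<close>

definition par_avg :: "(real \<Rightarrow> real) \<Rightarrow> real \<Rightarrow> (real \<times> real \<Rightarrow> complex) \<Rightarrow> real \<times> real \<Rightarrow> complex" where
  "par_avg \<phi> r f x = (LINT t|lebesgue. (\<phi> (t / r) / r) *\<^sub>R f (fst x - t, snd x - t\<^sup>2))"

definition par_max :: "(real \<Rightarrow> real) \<Rightarrow> (real \<times> real \<Rightarrow> complex) \<Rightarrow> real \<times> real \<Rightarrow> ennreal" where
  "par_max \<phi> f x = (SUP r\<in>{0<..}. ennreal (norm (par_avg \<phi> r f x)))"

definition par_box :: "real \<times> real \<Rightarrow> real \<Rightarrow> (real \<times> real) set" where
  "par_box z \<rho> = {fst z - \<rho>..fst z + \<rho>} \<times> {snd z - \<rho>\<^sup>2..snd z + \<rho>\<^sup>2}"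

text \<open>\<open>N\<close> is the number of vanishing moments, written \<open>N\<^sub>p\<close> in the literature.\<close>

definition par_atom ::
    "real \<Rightarrow> nat \<Rightarrow> real \<times> real \<Rightarrow> real \<Rightarrow> (real \<times> real \<Rightarrow> complex) \<Rightarrow> bool" where
  "par_atom p N z \<rho> a \<longleftrightarrow> \<rho> > 0 \<and>
     a \<in> borel_measurable lebesgue \<and> bounded (range a) \<and>
     closure {x. a x \<noteq> 0} \<subseteq> par_box z \<rho> \<and>
     (AE x in lebesgue. norm (a x) \<le> measure lebesgue (par_box z \<rho>) powr (- 1 / p)) \<and>
     (\<forall>\<beta>1 \<beta>2. \<beta>1 + \<beta>2 \<le> N \<longrightarrow> (LINT x|lebesgue. (fst x ^ \<beta>1 * snd x ^ \<beta>2) *\<^sub>R a x) = 0)"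

definition scale_cost :: "real \<Rightarrow> real \<Rightarrow> real" where
  "scale_cost p \<rho> = (min 1 \<rho>) powr (2 * p - 2)"

text \<open>
  Finite representations are included: the zero function is an atom for every box, so a finite sum is
  padded with zero terms. The \<open>n\<close>-th box is \<open>par_box (z n) (\<rho> n)\<close>; boxes may be repeated.
\<close>

definition par_repr ::
    "real \<Rightarrow> nat \<Rightarrow> (real \<times> real \<Rightarrow> complex) \<Rightarrow> (nat \<Rightarrow> complex) \<Rightarrow> (nat \<Rightarrow> real \<times> real) \<Rightarrow>
     (nat \<Rightarrow> real) \<Rightarrow> (nat \<Rightarrow> real \<times> real \<Rightarrow> complex) \<Rightarrow> bool" where
  "par_repr p N f c z \<rho> a \<longleftrightarrow>
     (\<forall>n. par_atom p N (z n) (\<rho> n) (a n)) \<and>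
     summable (\<lambda>n. norm (c n) powr p * scale_cost p (\<rho> n)) \<and>
     converges_L1_loc (\<lambda>n x. \<Sum>i<n. c i * a i x) f"

definition par_hardy :: "real \<Rightarrow> nat \<Rightarrow> (real \<times> real \<Rightarrow> complex) set" where
  "par_hardy p N = {f \<in> L1_loc. \<exists>c z \<rho> a. par_repr p N f c z \<rho> a}"

definition par_hardy_norm :: "real \<Rightarrow> nat \<Rightarrow> (real \<times> real \<Rightarrow> complex) \<Rightarrow> real" where
  "par_hardy_norm p N f =
     Inf {(\<Sum>n. norm (c n) powr p * scale_cost p (\<rho> n)) powr (1 / p) | c z \<rho> a. par_repr p N f c z \<rho> a}"

definition ennreal_powr :: "ennreal \<Rightarrow> real \<Rightarrow> ennreal" where
  "ennreal_powr x s = (if x = \<infinity> then \<infinity> else ennreal (enn2real x powr s))" \<comment> \<open>used only for \<open>s > 0\<close>\<close>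

text \<open>
  Stated for functions with values in \<open>[0, \<infinity>]\<close>, since \<^const>\<open>par_max\<close> may be infinite; a
  complex function \<open>g\<close> is covered by passing \<open>\<lambda>x. ennreal (norm (g x))\<close>.
\<close>

definition weak_Lp_norm :: "real \<Rightarrow> (real \<times> real \<Rightarrow> ennreal) \<Rightarrow> ennreal" where
  "weak_Lp_norm p g =
     (SUP \<alpha>\<in>{0<..}. ennreal \<alpha> * ennreal_powr (emeasure lebesgue {x. g x > ennreal \<alpha>}) (1 / p))"

end

theory Submission
  imports Defs "HOL-Real_Asymp.Real_Asymp"
begin

text \<open>
  A single atom on the unit box already has infinite weak norm. Take \<open>a (x, y) = \<kappa> b x c y\<close>, where
  all required moments of \<open>b\<close> vanish and \<open>c\<close> is a nonnegative tent. At large scale \<open>R\<close> the parabola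
  crosses the unit box almost vertically, so the average picks up \<open>b\<close> at essentially one point,
  where it need not vanish, times the integral of \<open>c\<close>: no cancellation is seen. The crossing takes
  time of order \<open>1/R\<close>, hence the maximal function is at least of order \<open>R\<^sup>-\<^sup>2\<close> on a neighbourhood of
  a parabolic arc of area of order \<open>R\<^sup>2\<close>. The weak quasinorm is thus at least of order
  \<open>R\<^sup>-\<^sup>2 (R\<^sup>2)\<^bsup>1/p\<^esup>\<close>, which is unbounded as \<open>R\<close> grows because \<open>p < 1\<close>.
\<close>

section \<open>Parabolic averages of continuous functions\<close>

lemma par_bump_continuous:
  assumes "par_bump \<phi>"
  shows "continuous_on UNIV \<phi>"
proof -
  have "\<phi> differentiable (at x)" for x
    using assms unfolding par_bump_def smooth_def by (metis funpow_0)
  then show ?thesis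
    by (meson continuous_at_imp_continuous_on differentiable_imp_continuous_within)
qed

lemma par_bump_eq_0:
  assumes "par_bump \<phi>" "t \<le> 1/2 \<or> t \<ge> 5/2"
  shows "\<phi> t = 0"
proof (rule ccontr)
  assume "\<phi> t \<noteq> 0"
  then have "t \<in> closure {t. \<phi> t \<noteq> 0}"
    using closure_subset by fastforce
  then show False
    using assms unfolding par_bump_def by (auto dest!: subsetD)
qed

text \<open>The factor \<open>\<phi> (t / r)\<close> vanishes outside \<open>{r/2..5*r/2}\<close>,
  which leaves a continuous integrand on a compact interval; in this form continuity in the
  parameter \<open>x\<close> can be quoted.\<close>

lemma
  fixes g :: "real \<times> real \<Rightarrow> complex"
  assumes bump: "par_bump \<phi>" and r: "r > 0" and g: "continuous_on UNIV g"
  shows par_avg_integrable: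
      "integrable lebesgue (\<lambda>t. (\<phi> (t / r) / r) *\<^sub>R g (fst x - t, snd x - t\<^sup>2))" (is ?int)
    and par_avg_eq_integral: "par_avg \<phi> r g x =
      integral (cbox (r/2) (5*r/2)) (\<lambda>t. (\<phi> (t / r) / r) *\<^sub>R g (fst x - t, snd x - t\<^sup>2))" (is ?eq)
proof -
  let ?h = "\<lambda>t. (\<phi> (t / r) / r) *\<^sub>R g (fst x - t, snd x - t\<^sup>2)"
  have "continuous_on (cbox (r/2) (5*r/2)) ?h"
    by (intro continuous_intros continuous_on_compose2[OF par_bump_continuous[OF bump]]
        continuous_on_compose2[OF g]) (use r in auto)
  then have abs: "set_integrable lebesgue (cbox (r/2) (5*r/2)) ?h"
    by (rule absolutely_integrable_continuous)
  have eq: "(\<lambda>t. indicator (cbox (r/2) (5*r/2)) t *\<^sub>R ?h t) = ?h"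
  proof
    fix t
    show "indicator (cbox (r/2) (5*r/2)) t *\<^sub>R ?h t = ?h t"
    proof (cases "t \<in> cbox (r/2) (5*r/2)")
      case False
      then have "\<phi> (t / r) = 0"
        using r by (intro par_bump_eq_0[OF bump]) (auto simp: field_simps)
      then show ?thesis by simp
    qed simp
  qed
  show ?int
    using abs unfolding set_integrable_def eq .
  show ?eq
    using set_lebesgue_integral_eq_integral(2)[OF abs]
    unfolding set_lebesgue_integral_def eq par_avg_def .
qed

lemma continuous_on_par_avg:
  fixes g :: "real \<times> real \<Rightarrow> complex"
  assumes bump: "par_bump \<phi>" and r: "r > 0" and g: "continuous_on UNIV g"
  shows "continuous_on UNIV (par_avg \<phi> r g)"
proof -
  have "continuous_on UNIV (\<lambda>x. integral (cbox (r/2) (5*r/2))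
      (\<lambda>t. (\<phi> (t / r) / r) *\<^sub>R g (fst x - t, snd x - t\<^sup>2)))"
    by (intro integral_continuous_on_param)
      (auto intro!: continuous_intros continuous_on_compose2[OF par_bump_continuous[OF bump]]
        continuous_on_compose2[OF g] simp: case_prod_beta, use r in auto)
  then show ?thesis
    by (simp add: par_avg_eq_integral[OF bump r g] cong: continuous_on_cong)
qed

text \<open>
  Needed because \<^const>\<open>emeasure\<close> is 0 on nonmeasurable sets, so a lower bound for the measure of a
  superlevel set requires its measurability.
\<close>

lemma open_par_max_gt:
  assumes bump: "par_bump \<phi>" and g: "continuous_on UNIV g"
  shows "open {x. par_max \<phi> g x > \<alpha>}"
proof -
  have "{x. par_max \<phi> g x > \<alpha>} = (\<Union>r\<in>{0<..}. {x. ennreal (norm (par_avg \<phi> r g x)) > \<alpha>})"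
    by (auto simp: par_max_def less_SUP_iff)
  also have "open \<dots>"
    by (intro open_UN ballI open_Collect_less continuous_intros continuous_on_ennreal)
      (use continuous_on_par_avg[OF bump _ g] in auto)
  finally show ?thesis .
qed

section \<open>A compactly supported function with vanishing moments\<close>

text \<open>
  Dilation by 2 multiplies the \<open>n\<close>-th moment by \<open>2 ^ - Suc n\<close>, so the recursion kills the \<open>n\<close>-th
  moment and preserves the vanishing of the lower ones, without changing the values on \<open>{1/2<..1}\<close>.
\<close>

fun osc :: "nat \<Rightarrow> real \<Rightarrow> real" where
  "osc 0 x = max 0 (x * (1 - x))"
| "osc (Suc n) x = osc n x - 2 ^ Suc n * osc n (2 * x)"

lemma continuous_on_osc [continuous_intros]:
  "continuous_on A f \<Longrightarrow> continuous_on A (\<lambda>x. osc n (f x))"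
proof (induction n arbitrary: f)
  case 0
  then show ?case
    unfolding osc.simps by (intro continuous_intros)
next
  case (Suc n)
  show ?case
    unfolding osc.simps by (intro continuous_intros Suc)
qed

lemma osc_eq_0: "x \<notin> {0..1} \<Longrightarrow> osc n x = 0"
proof (induction n arbitrary: x)
  case 0
  then have "x * (1 - x) \<le> 0"
    by (auto simp: mult_le_0_iff)
  then show ?case by simp
qed auto

text \<open>For \<open>x > 1/2\<close> the argument \<open>2 * x\<close> lies beyond
  \<open>1\<close>, outside the support, so each recursion step subtracts zero.\<close>

lemma osc_eq: "x \<in> {1/2<..1} \<Longrightarrow> osc n x = x * (1 - x)"
  by (induction n) (auto simp: osc_eq_0)

lemma integrable_osc: "integrable lborel (\<lambda>x. x ^ k * osc n x)"
proof -
  have "integrable lborel (\<lambda>x. indicator {0..1} x *\<^sub>R (x ^ k * osc n x))"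
    by (intro borel_integrable_compact continuous_intros) auto
  also have "(\<lambda>x. indicator {0..1} x *\<^sub>R (x ^ k * osc n x)) = (\<lambda>x. x ^ k * osc n x)"
    using osc_eq_0 by (auto simp: indicator_def fun_eq_iff)
  finally show ?thesis .
qed

lemma integral_osc_double:
  "(LINT x|lborel. x ^ k * osc n x) = 2 ^ Suc k * (LINT x|lborel. x ^ k * osc n (2 * x))"
  by (subst lborel_integral_real_affine[where c = 2 and t = 0])
    (simp_all add: power_mult_distrib mult.assoc)

lemma osc_moment: "k < n \<Longrightarrow> (LINT x|lborel. x ^ k * osc n x) = 0"
proof (induction n)
  case (Suc n)
  have "integrable lborel (\<lambda>x. (2 * x) ^ k * osc n (2 * x))"
    using lborel_integrable_real_affine[OF integrable_osc[of k n], of 2 0] by simp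
  then have int: "integrable lborel (\<lambda>x. x ^ k * osc n (2 * x))"
    by (simp add: power_mult_distrib mult.assoc)
  have "(LINT x|lborel. x ^ k * osc (Suc n) x)
      = (LINT x|lborel. x ^ k * osc n x - 2 ^ Suc n * (x ^ k * osc n (2 * x)))"
    by (simp add: algebra_simps)
  also have "\<dots> = (LINT x|lborel. x ^ k * osc n x) - 2 ^ Suc n * (LINT x|lborel. x ^ k * osc n (2 * x))"
    by (subst Bochner_Integration.integral_diff) (use int integrable_osc in auto)
  \<comment> \<open>For \<open>k = n\<close> the factor \<open>2 ^ Suc n\<close> makes the two terms
    cancel; for \<open>k < n\<close> the first integral vanishes by induction and the second is a
    multiple of it.\<close>
  also have "\<dots> = 0"
    using Suc integral_osc_double[of k n] by (cases "k = n") auto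
  finally show ?case .
qed simp

section \<open>The atom profile in the plane\<close>

definition profile :: "nat \<Rightarrow> real \<times> real \<Rightarrow> real" where
  "profile n x = osc n (fst x) * max 0 (1 - \<bar>snd x\<bar>)"

lemma continuous_on_profile [continuous_intros]:
  "continuous_on A f \<Longrightarrow> continuous_on A (\<lambda>x. profile n (f x))"
  unfolding profile_def by (intro continuous_intros)

lemma profile_eq_0: "x \<notin> par_box (0, 0) 1 \<Longrightarrow> profile n x = 0"
  unfolding profile_def par_box_def by (cases x; cases "fst x \<in> {0..1}") (auto simp: osc_eq_0)

lemma par_box_unit: "par_box (0, 0) 1 = cbox (-1, -1) (1, 1)"
  by (auto simp: par_box_def cbox_Pair_eq)

lemma measure_par_box_unit: "measure lebesgue (par_box (0, 0) 1) = 4"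
proof -
  have "measure lebesgue (par_box (0, 0) 1) = measure lborel (cbox (-1, -1) (1, 1) :: (real \<times> real) set)"
    unfolding par_box_unit by simp
  also have "\<dots> = 4"
    by (subst content_Pair) simp
  finally show ?thesis .
qed

lemma profile_bounded: "\<exists>B>0. \<forall>x. \<bar>profile n x\<bar> \<le> B"
proof -
  have "compact (profile n ` par_box (0, 0) 1)"
    unfolding par_box_unit by (intro compact_continuous_image continuous_intros compact_cbox)
  then obtain B where "B > 0" "\<And>x. x \<in> par_box (0, 0) 1 \<Longrightarrow> \<bar>profile n x\<bar> \<le> B"
    by (auto dest!: compact_imp_bounded simp: bounded_pos)
  then show ?thesis
    by (metis profile_eq_0 abs_zero less_imp_le)
qed

text \<open>Integrating over the first variable first gives a vanishing moment of \<open>osc\<close>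
  at every fixed height, whatever the power \<open>k\<close> of the second variable.\<close>

lemma profile_moment:
  assumes "j < n"
  shows "(LINT x|lebesgue. fst x ^ j * snd x ^ k * profile n x) = 0"
proof -
  let ?F = "\<lambda>x. fst x ^ j * snd x ^ k * profile n x"
  have cont: "continuous_on A ?F" for A
    by (intro continuous_intros)
  have "integrable lborel (\<lambda>x. indicator (par_box (0, 0) 1) x *\<^sub>R ?F x)"
    unfolding par_box_unit by (intro borel_integrable_compact cont compact_cbox)
  also have "(\<lambda>x. indicator (par_box (0, 0) 1) x *\<^sub>R ?F x) = ?F"
    using profile_eq_0 by (auto simp: indicator_def fun_eq_iff)
  finally have int: "integrable (lborel \<Otimes>\<^sub>M lborel) ?F"
    by (simp add: lborel_prod)
  have "(LINT x|lebesgue. ?F x) = (LINT x|(lborel \<Otimes>\<^sub>M lborel). ?F x)"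
    unfolding lborel_prod using cont
    by (intro integral_completion) (auto intro: borel_measurable_continuous_onI)
  also have "\<dots> = (LINT y|lborel. LINT x|lborel. ?F (x, y))"
    using lborel_pair.integral_snd[of "\<lambda>x y. ?F (x, y)"] int by (simp add: case_prod_beta')
  also have "\<dots> = (LINT y|lborel. LINT x|lborel. (y ^ k * max 0 (1 - \<bar>y\<bar>)) * (x ^ j * osc n x))"
    by (intro Bochner_Integration.integral_cong refl) (simp add: profile_def)
  also have "\<dots> = 0"
    by (simp add: osc_moment[OF assms])
  finally show ?thesis .
qed

section \<open>Membership in the atomic space\<close>

lemma continuous_in_L1_loc:
  fixes f :: "real \<times> real \<Rightarrow> complex"
  assumes "continuous_on UNIV f"
  shows "f \<in> L1_loc"
proof -
  have "set_integrable lebesgue K f" if "compact K" for K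
  proof -
    have "integrable lborel (\<lambda>x. indicator K x *\<^sub>R f x)"
      using that assms by (intro borel_integrable_compact) (auto intro: continuous_on_subset)
    then show ?thesis
      unfolding set_integrable_def by (simp add: integrable_completion)
  qed
  then show ?thesis by (simp add: L1_loc_def)
qed

text \<open>One term with coefficient 1 is a representation; since every index must carry an atom,
  the remaining ones repeat \<open>a\<close> with coefficient 0.\<close>

lemma atom_in_par_hardy:
  assumes a: "par_atom p N z \<rho> a" and L: "a \<in> L1_loc"
  shows "a \<in> par_hardy p N"
proof -
  define c :: "nat \<Rightarrow> complex" where "c = (\<lambda>n. if n = 0 then 1 else 0)"
  have sum: "(\<Sum>i<n. c i * a x) = (if n = 0 then 0 else a x)" for n x
    by (auto simp: c_def if_distribR sum.delta cong: if_cong simp flip: sum_distrib_right)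
  have "(\<lambda>x. \<Sum>i<n. c i * a x) \<in> L1_loc" for n
    using L by (cases "n = 0") (auto simp: sum intro: continuous_in_L1_loc)
  \<comment> \<open>The partial sum at \<open>n = 0\<close> is empty; all later ones equal
    \<open>a\<close>, so the error is zero from index 1 on.\<close>
  moreover have "(\<lambda>n. LINT x:K|lebesgue. norm ((\<Sum>i<n. c i * a x) - a x)) \<longlonglongrightarrow> 0" for K
    by (rule tendsto_eventually, rule eventually_sequentiallyI[of 1]) (simp add: sum)
  moreover have "summable (\<lambda>n. norm (c n) powr p * scale_cost p \<rho>)"
    by (rule summable_finite[of "{0}"]) (auto simp: c_def)
  ultimately have "par_repr p N a c (\<lambda>_. z) (\<lambda>_. \<rho>) (\<lambda>_. a)"
    unfolding par_repr_def converges_L1_loc_def using a L by simp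
  then show ?thesis
    using L by (auto simp: par_hardy_def)
qed

text \<open>The bound \<open>4 powr (- 1 / p)\<close> is the height allowed on the unit box, which
  has area 4. The order is \<open>Suc N\<close> because \<open>osc_moment\<close> covers moments
  strictly below the order, while those up to \<open>N\<close> must vanish.\<close>

lemma par_atom_profile:
  assumes \<kappa>: "\<And>x. \<bar>\<kappa> * profile (Suc N) x\<bar> \<le> 4 powr (- 1 / p)"
  shows "par_atom p N (0, 0) 1 (\<lambda>x. of_real (\<kappa> * profile (Suc N) x))"
proof -
  let ?a = "\<lambda>x. of_real (\<kappa> * profile (Suc N) x) :: complex"
  have cont: "continuous_on UNIV ?a"
    by (intro continuous_intros)
  have "?a \<in> borel_measurable lebesgue"
    using borel_measurable_continuous_onI[OF cont] by (simp add: measurable_completion)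
  moreover have "bounded (range ?a)"
    unfolding bounded_iff using \<kappa>
    by (intro exI[of _ "4 powr (- 1 / p)"]) (auto simp only: norm_of_real)
  moreover have "closure {x. ?a x \<noteq> 0} \<subseteq> par_box (0, 0) 1"
    by (intro closure_minimal) (use profile_eq_0 in \<open>auto simp: par_box_unit\<close>)
  moreover have "AE x in lebesgue. norm (?a x) \<le> measure lebesgue (par_box (0, 0) 1) powr (- 1 / p)"
    unfolding measure_par_box_unit norm_of_real by (intro AE_I2 \<kappa>)
  moreover have "(LINT x|lebesgue. (fst x ^ j * snd x ^ k) *\<^sub>R ?a x) = 0" if "j + k \<le> N" for j k
  proof -
    have "(LINT x|lebesgue. (fst x ^ j * snd x ^ k) *\<^sub>R ?a x)
        = (LINT x|lebesgue. of_real (\<kappa> * (fst x ^ j * snd x ^ k * profile (Suc N) x)))"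
      by (intro Bochner_Integration.integral_cong refl)
        (simp add: scaleR_conv_of_real mult_ac)
    also have "\<dots> = 0"
      unfolding integral_complex_of_real using that by (simp add: profile_moment)
    finally show ?thesis .
  qed
  ultimately show ?thesis
    unfolding par_atom_def using zero_less_one by blast
qed

section \<open>Lower bound near a parabolic arc\<close>

text \<open>The parabola traced backwards from \<open>x\<close> meets height 0 at time
  \<open>sqrt (snd x)\<close>, with first coordinate \<open>fst x - sqrt (snd x)\<close>. This is
  kept near \<open>3/4\<close>, well inside \<open>{1/2<..1}\<close>; for \<open>R > 0\<close> the
  time lies between \<open>sqrt 2 * R\<close> and \<open>sqrt 3 * R\<close>, where the bump at scale
  \<open>R\<close> is 1.\<close>

definition par_strip :: "real \<Rightarrow> (real \<times> real) set" where
  "par_strip R = {x. snd x \<in> {2 * R\<^sup>2..3 * R\<^sup>2} \<and> fst x - sqrt (snd x) \<in> {11/16..13/16}}"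

text \<open>Horizontal sections are intervals of length \<open>1/8\<close>, over a range of heights
  of length \<open>R\<^sup>2\<close>.\<close>

lemma emeasure_par_strip: "emeasure lebesgue (par_strip R) = ennreal (R\<^sup>2 / 8)"
proof -
  have "closed (par_strip R)"
    unfolding par_strip_def atLeastAtMost_iff
    by (intro closed_Collect_conj closed_Collect_le continuous_intros)
  then have sets: "par_strip R \<in> sets borel"
    by simp
  have sections: "emeasure lborel ((\<lambda>x. (x, y)) -` par_strip R)
      = ennreal (1/8) * indicator {2 * R\<^sup>2..3 * R\<^sup>2} y" for y
  proof (cases "y \<in> {2 * R\<^sup>2..3 * R\<^sup>2}")
    case True
    then have "(\<lambda>x. (x, y)) -` par_strip R = {11/16 + sqrt y..13/16 + sqrt y}"
      by (auto simp: par_strip_def)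
    with True show ?thesis by simp
  next
    case False
    then have "(\<lambda>x. (x, y)) -` par_strip R = {}"
      by (auto simp: par_strip_def)
    with False show ?thesis by simp
  qed
  have "emeasure lebesgue (par_strip R) = emeasure (lborel \<Otimes>\<^sub>M lborel) (par_strip R)"
    using sets by (simp add: lborel_prod)
  also have "\<dots> = (\<integral>\<^sup>+y. emeasure lborel ((\<lambda>x. (x, y)) -` par_strip R) \<partial>lborel)"
    by (rule lborel_pair.emeasure_pair_measure_alt2)
      (use sets in \<open>simp only: lborel_prod sets_lborel\<close>)
  also have "\<dots> = ennreal (1/8) * ennreal (R\<^sup>2)"
    unfolding sections by (subst nn_integral_cmult_indicator) auto
  also have "\<dots> = ennreal (R\<^sup>2 / 8)"
    by (simp flip: ennreal_mult)
  finally show ?thesis .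
qed

text \<open>Where the tent is nonzero, \<open>\<bar>s - t\<bar> * (s + t) < 1\<close> with
  \<open>s = sqrt (snd x)\<close> and \<open>s + t \<ge> 16\<close> puts \<open>t\<close> within
  \<open>1/16\<close> of \<open>s\<close>. Hence \<open>osc\<close> is evaluated in
  \<open>{5/8..7/8}\<close>, where it is at least \<open>5/64\<close>.\<close>

lemma profile_ge:
  assumes R: "R \<ge> 16" and x: "x \<in> par_strip R" and t: "t > R / 2"
  shows "profile n (fst x - t, snd x - t\<^sup>2) \<ge> 1/16 * max 0 (1 - \<bar>snd x - t\<^sup>2\<bar>)"
proof (cases "\<bar>snd x - t\<^sup>2\<bar> < 1")
  case True
  define s where "s = sqrt (snd x)"
  have "R\<^sup>2 \<le> snd x"
    using x by (auto simp: par_strip_def intro: order_trans[of _ "2 * R\<^sup>2"])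
  then have s: "s\<^sup>2 = snd x" "R \<le> s"
    using R by (auto simp: s_def real_le_rsqrt intro: order_trans[of _ "R\<^sup>2"])
  have "\<bar>s - t\<bar> * 16 \<le> \<bar>s - t\<bar> * (s + t)"
    using s t R by (intro mult_left_mono) auto
  also have "\<dots> = \<bar>(s - t) * (s + t)\<bar>"
    using s t R by (simp add: abs_mult)
  also have "\<dots> = \<bar>snd x - t\<^sup>2\<bar>"
    unfolding s(1)[symmetric] by (simp add: power2_eq_square algebra_simps)
  finally have "\<bar>s - t\<bar> \<le> 1/16"
    using True by simp
  moreover have "fst x - s \<in> {11/16..13/16}"
    using x by (simp add: par_strip_def s_def)
  ultimately have v: "5/8 \<le> fst x - t" "fst x - t \<le> 7/8"
    unfolding atLeastAtMost_iff by linarith+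
  then have "1/16 \<le> (5/8) * (1 - (7/8) :: real)" by simp
  also have "\<dots> \<le> (fst x - t) * (1 - (fst x - t))"
    using v by (intro mult_mono) auto
  also have "\<dots> = osc n (fst x - t)"
    using v by (subst osc_eq) auto
  finally show ?thesis
    unfolding profile_def fst_conv snd_conv by (intro mult_right_mono) auto
qed (simp add: profile_def)

text \<open>On an interval of length \<open>1 / (8 * R)\<close> the integrand is at least
  \<open>\<kappa> / (32 * R)\<close>, and it is nonnegative elsewhere.\<close>

lemma par_avg_profile_ge:
  assumes bump: "par_bump \<phi>" and R: "R \<ge> 16" and x: "x \<in> par_strip R" and \<kappa>: "\<kappa> > 0"
  shows "norm (par_avg \<phi> R (\<lambda>y. of_real (\<kappa> * profile n y)) x) \<ge> \<kappa> / (256 * R\<^sup>2)"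
proof -
  define s where "s = sqrt (snd x)"
  \<comment> \<open>The length makes \<open>t\<^sup>2 - snd x = (t - s) * (t + s)\<close> at most
    \<open>1 / (8 * R) * (4 * R) = 1/2\<close>, so the tent stays at least
    \<open>1/2\<close>.\<close>
  let ?I = "{s..s + 1 / (8 * R)}"
  let ?g = "\<lambda>t. (\<phi> (t / R) / R) * (\<kappa> * profile n (fst x - t, snd x - t\<^sup>2))"
  have x2: "2 * R\<^sup>2 \<le> snd x" "snd x \<le> 3 * R\<^sup>2"
    using x by (auto simp: par_strip_def)
  have s2: "s\<^sup>2 = snd x"
    using x2(1) by (simp add: s_def order_trans[OF _ x2(1)])
  have s_gt: "R < s"
    unfolding s_def using x2(1) R by (intro real_less_rsqrt) (smt (verit) zero_less_power)
  \<comment> \<open>\<open>7/4\<close> is a rational bound for \<open>sqrt 3\<close> that leaves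
    room for all of \<open>?I\<close> below \<open>2 * R\<close>.\<close>
  have s_le: "s \<le> 7/4 * R"
    unfolding s_def
  proof (rule real_le_lsqrt)
    have "snd x \<le> 49/16 * R\<^sup>2"
      using x2(2) zero_le_power2[of R] by linarith
    then show "snd x \<le> (7/4 * R)\<^sup>2"
      by (simp add: power_mult_distrib power_divide)
  qed (use R in simp)
  have R_inv: "1 / (8 * R) \<le> 1/8"
    using R by (simp add: field_simps)
  have int: "integrable lebesgue (\<lambda>t. (\<phi> (t / R) / R) *\<^sub>R
      (of_real (\<kappa> * profile n (fst x - t, snd x - t\<^sup>2)) :: complex))"
    using R by (intro par_avg_integrable[OF bump, of R "\<lambda>y. of_real (\<kappa> * profile n y)"]
        continuous_intros) auto
  have int_g: "integrable lebesgue ?g"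
    using integrable_Re[OF int] by (simp only: scaleR_complex.sel Re_complex_of_real)
  have avg: "par_avg \<phi> R (\<lambda>y. of_real (\<kappa> * profile n y)) x = of_real (LINT t|lebesgue. ?g t)"
    unfolding par_avg_def integral_complex_of_real[symmetric]
    by (simp only: scaleR_conv_of_real of_real_mult)
  have ge: "\<kappa> / (32 * R) * indicator ?I t \<le> ?g t" for t
  proof (cases "t > R / 2")
    case False
    then have "\<phi> (t / R) = 0"
      using R by (intro par_bump_eq_0[OF bump]) (auto simp: field_simps)
    moreover have "t \<notin> ?I"
      using False s_gt R by auto
    ultimately show ?thesis by simp
  next
    case True
    note prof = profile_ge[OF R x True, of n]
    show ?thesis
    proof (cases "t \<in> ?I")
      case False
      have "0 \<le> profile n (fst x - t, snd x - t\<^sup>2)"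
        by (rule order_trans[OF _ prof]) simp
      moreover have "0 \<le> \<phi> (t / R)"
        using bump by (simp add: par_bump_def)
      ultimately show ?thesis
        using False R \<kappa> by simp
    next
      case t: True
      have "R < t" "t < 2 * R"
        using t s_gt s_le R_inv R unfolding atLeastAtMost_iff by linarith+
      then have "\<phi> (t / R) = 1"
        using bump R by (auto simp: par_bump_def field_simps)
      have "t\<^sup>2 - snd x = (t - s) * (t + s)"
        unfolding s2[symmetric] by (simp add: power2_eq_square algebra_simps)
      also have "\<dots> \<le> 1 / (8 * R) * (4 * R)"
        using t \<open>t < 2 * R\<close> s_le s_gt R by (intro mult_mono) auto
      also have "\<dots> = 1/2"
        using R by simp
      finally have "t\<^sup>2 - snd x \<le> 1/2" .
      moreover have "snd x \<le> t\<^sup>2"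
        unfolding s2[symmetric] using t s_gt R by (intro power_mono) auto
      ultimately have "1/32 \<le> profile n (fst x - t, snd x - t\<^sup>2)"
        using prof by (simp add: max_def split: if_splits)
      then have "1 / R * (\<kappa> * (1/32)) \<le> 1 / R * (\<kappa> * profile n (fst x - t, snd x - t\<^sup>2))"
        using R \<kappa> by (intro mult_left_mono) auto
      with t \<open>\<phi> (t / R) = 1\<close> show ?thesis by (simp add: mult.commute)
    qed
  qed
  have "\<kappa> / (256 * R\<^sup>2) = (LINT t|lebesgue. \<kappa> / (32 * R) * indicator ?I t)"
    using R by (simp add: power2_eq_square)
  also have "\<dots> \<le> (LINT t|lebesgue. ?g t)"
    by (intro integral_mono int_g ge integrable_mult_right integrable_real_indicator)
      (auto simp: emeasure_lborel_Icc_eq)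
  finally show ?thesis
    unfolding avg norm_of_real by linarith
qed

section \<open>Blow-up of the weak norm\<close>

lemma weak_Lp_norm_ge:
  assumes p: "p > 0" and \<alpha>: "\<alpha> > 0" and m: "m \<ge> 0"
    and le: "ennreal m \<le> emeasure lebesgue {x. g x > ennreal \<alpha>}"
  shows "ennreal (\<alpha> * m powr (1 / p)) \<le> weak_Lp_norm p g"
proof -
  let ?E = "emeasure lebesgue {x. g x > ennreal \<alpha>}"
  have "ennreal (m powr (1 / p)) \<le> ennreal_powr ?E (1 / p)"
  \<comment> \<open>\<open>enn2real\<close> sends infinity to 0, so infinite measure is a separate
    case.\<close>
  proof (cases "?E = \<infinity>")
    case False
    then have "m \<le> enn2real ?E"
      using le m by (metis enn2real_ennreal enn2real_mono infinity_ennreal_def top.not_eq_extremum)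
    then show ?thesis
      using False m p by (auto simp: ennreal_powr_def intro!: ennreal_leI powr_mono2)
  qed (simp add: ennreal_powr_def)
  then have "ennreal (\<alpha> * m powr (1 / p)) \<le> ennreal \<alpha> * ennreal_powr ?E (1 / p)"
    using \<alpha> by (simp add: ennreal_mult mult_left_mono)
  also have "\<dots> \<le> weak_Lp_norm p g"
    unfolding weak_Lp_norm_def using \<alpha> by (intro SUP_upper) auto
  finally show ?thesis .
qed

lemma weak_Lp_norm_profile:
  assumes bump: "par_bump \<phi>" and p: "0 < p" "p < 1" and \<kappa>: "\<kappa> > 0"
  shows "weak_Lp_norm p (par_max \<phi> (\<lambda>x. of_real (\<kappa> * profile n x))) = \<infinity>"
proof (rule ccontr)
  let ?a = "\<lambda>x. of_real (\<kappa> * profile n x) :: complex"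
  assume "weak_Lp_norm p (par_max \<phi> ?a) \<noteq> \<infinity>"
  then obtain K where K: "weak_Lp_norm p (par_max \<phi> ?a) = ennreal K" "K \<ge> 0"
    by (cases "weak_Lp_norm p (par_max \<phi> ?a)") auto
  \<comment> \<open>The level is half the lower bound for the average, which makes the superlevel
    inequality strict.\<close>
  have bound: "\<kappa> / (512 * R\<^sup>2) * (R\<^sup>2 / 8) powr (1 / p) \<le> K" if R: "R \<ge> 16" for R
  proof -
    let ?L = "{x. par_max \<phi> ?a x > ennreal (\<kappa> / (512 * R\<^sup>2))}"
    have "open ?L"
      by (intro open_par_max_gt[OF bump] continuous_intros)
    then have "?L \<in> sets lebesgue"
      by (simp add: borel_open)
    moreover have "par_strip R \<subseteq> ?L"
    proof
      fix x assume x: "x \<in> par_strip R"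
      have "\<kappa> / (512 * R\<^sup>2) < \<kappa> / (256 * R\<^sup>2)"
        using R \<kappa> by (simp add: divide_simps)
      also have "\<dots> \<le> norm (par_avg \<phi> R ?a x)"
        by (rule par_avg_profile_ge[OF bump R x \<kappa>])
      finally have "ennreal (\<kappa> / (512 * R\<^sup>2)) < ennreal (norm (par_avg \<phi> R ?a x))"
        using \<kappa> by (subst ennreal_less_iff) auto
      also have "\<dots> \<le> par_max \<phi> ?a x"
        unfolding par_max_def using R by (intro SUP_upper) auto
      finally show "x \<in> ?L" by simp
    qed
    ultimately have "ennreal (R\<^sup>2 / 8) \<le> emeasure lebesgue ?L"
      unfolding emeasure_par_strip[symmetric] by (intro emeasure_mono)
    then have "ennreal (\<kappa> / (512 * R\<^sup>2) * (R\<^sup>2 / 8) powr (1 / p)) \<le> ennreal K"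
      unfolding K(1)[symmetric] using R \<kappa> p by (intro weak_Lp_norm_ge) auto
    then show ?thesis
      using K(2) by (simp add: ennreal_le_iff)
  qed
  \<comment> \<open>With \<open>q > 1\<close> the left side of \<open>bound\<close> grows like
    \<open>R powr (2 * q - 2)\<close> and so exceeds \<open>K\<close>.\<close>
  define q where "q = 1 / p"
  have "q > 1"
    using p by (simp add: q_def)
  then have "filterlim (\<lambda>R. \<kappa> / (512 * R\<^sup>2) * (R\<^sup>2 / 8) powr q) at_top at_top"
    using \<kappa> by real_asymp
  then have "\<forall>\<^sub>F R in at_top. \<kappa> / (512 * R\<^sup>2) * (R\<^sup>2 / 8) powr q > K"
    by (simp add: filterlim_at_top_dense)
  then have "\<forall>\<^sub>F R::real in at_top. False"
    using eventually_ge_at_top[of "16::real"] by eventually_elim (use bound in \<open>force simp: q_def\<close>)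
  then show False by simp
qed

theorem proposition3p2:
  fixes \<phi> :: "real \<Rightarrow> real" and p :: real and N :: nat
  assumes "par_bump \<phi>"
    and "0 < p" and "p < 1"
    and "N > 0" and "int N \<ge> \<lfloor>3 * (1 / p - 1)\<rfloor>"
  shows "\<not> (\<exists>C::real. \<forall>f\<in>par_hardy p N.
           weak_Lp_norm p (par_max \<phi> f) \<le> ennreal (C * par_hardy_norm p N f))"
proof -
  obtain B where B: "B > 0" "\<And>x. \<bar>profile (Suc N) x\<bar> \<le> B"
    using profile_bounded[of "Suc N"] by blast
  \<comment> \<open>Rescales the sup bound \<open>B\<close> to the height allowed for an atom on the
    unit box.\<close>
  define \<kappa> where "\<kappa> = 4 powr (- 1 / p) / B"
  have \<kappa>: "\<kappa> > 0"
    using B(1) by (simp add: \<kappa>_def)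
  let ?a = "\<lambda>x. of_real (\<kappa> * profile (Suc N) x) :: complex"
  have "\<bar>\<kappa> * profile (Suc N) x\<bar> \<le> \<kappa> * B" for x
    using B \<kappa> by (simp add: abs_mult)
  then have "par_atom p N (0, 0) 1 ?a"
    using B(1) by (intro par_atom_profile) (simp add: \<kappa>_def)
  then have "?a \<in> par_hardy p N"
    by (rule atom_in_par_hardy) (intro continuous_in_L1_loc continuous_intros)
  moreover have "weak_Lp_norm p (par_max \<phi> ?a) = \<infinity>"
    using assms \<kappa> by (intro weak_Lp_norm_profile)
  \<comment> \<open>Whatever real values \<open>C\<close> and the norm of \<open>?a\<close> take,
    the right side is \<open>ennreal\<close> of a real, hence finite.\<close>
  ultimately show ?thesis
    by (metis ennreal_neq_top infinity_ennreal_def top_unique)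
qed

end
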